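(* Let $L$ be an infinite rational language over a finite alphabet. Then $L$ is adev (has an almost dominating eigenvalue) if and only if the local growth rate $\gamma_L$ exists. In this case, the modulus of $L$ is equal to $\gamma_L$.
   Context: A language is rational if it is accepted by a finite automaton. For a language $L$ over a finite alphabet, $\mathbf{u}_L(\ell)$ is the number of words of $L$ of length $\ell$. The local growth rate of $L$ is the (finite) limit, if it exists, $\gamma_L=\lim_{\ell\to\infty}\mathbf{u}_L(\ell+1)/\mathbf{u}_L(\ell)$ (in particular $\mathbf{u}_L(\ell)\neq 0$ for all large $\ell$). The generating function of $L$ is $\mathsf{g}_L(z)=\sum_{\ell\ge0}\mathbf{u}_L(\ell)z^\ell$; for $L$ rational and infinite it is a rational function which is not a polynomial, and can be written $\mathsf{g}_L(z)=T(z)+\frac{R(z)}{S(z)}$ with $T,R,S\in\mathbb{Q}[z]$, $R$ and $S$ coprime, $\deg R<\deg S$, $S(0)\neq0$. Let $\mathsf{P}_L(z)=z^{\deg S}S(1/z)$ be the reciprocal polynomial of $S$. The eigenvalues of $L$ are the complex zeroes of $\mathsf{P}_L$, with their multiplicities as zeroes of $\mathsf{P}_L$. The modulus of $L$ is the maximum $\lambda$ of the moduli of its eigenvalues; it is known that $\lambda$ is itself an eigenvalue of $L$. The language $L$ is adev (has an almost dominating eigenvalue) if every eigenvalue of modulus $\lambda$ other than $\lambda$ itself has multiplicity strictly less than the multiplicity of the eigenvalue $\lambda$. *)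

theory Defs
  imports Complex_Main "HOL-Computational_Algebra.Computational_Algebra"
begin

section \<open>Rational languages\<close>

record ('q, 'a) automaton =
  states :: "'q set"
  transitions :: "('q \<times> 'a \<times> 'q) set"
  initials :: "'q set"
  finals :: "'q set"

definition finite_automaton :: "'a set \<Rightarrow> ('q, 'a) automaton \<Rightarrow> bool" where
  "finite_automaton A M \<longleftrightarrow>
     finite (states M) \<and> transitions M \<subseteq> states M \<times> A \<times> states M \<and>
     initials M \<subseteq> states M \<and> finals M \<subseteq> states M"

primrec path_labelled :: "('q, 'a) automaton \<Rightarrow> 'q \<Rightarrow> 'a list \<Rightarrow> 'q \<Rightarrow> bool" where
  "path_labelled M p [] q \<longleftrightarrow> p = q"
| "path_labelled M p (a # w) q \<longleftrightarrow> (\<exists>r. (p, a, r) \<in> transitions M \<and> path_labelled M r w q)"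

definition accepted_language :: "('q, 'a) automaton \<Rightarrow> 'a list set" where
  "accepted_language M = {w. \<exists>p\<in>initials M. \<exists>q\<in>finals M. path_labelled M p w q}"

text \<open>
  States are taken to be natural numbers because a definition cannot quantify over types.
  The lemma \<open>rational_languageI\<close> below shows that this is no restriction.
\<close>
definition rational_language :: "'a set \<Rightarrow> 'a list set \<Rightarrow> bool" where
  "rational_language A L \<longleftrightarrow>
     (\<exists>M :: (nat, 'a) automaton. finite_automaton A M \<and> accepted_language M = L)"

lemma rational_languageI:
  fixes M :: "('q, 'a) automaton"
  assumes M: "finite_automaton A M"
  shows "rational_language A (accepted_language M)"
proof -
  have "finite (states M)"
    using M by (simp add: finite_automaton_def)
  then obtain f :: "'q \<Rightarrow> nat" where f: "inj_on f (states M)"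
    using finite_imp_inj_to_nat_seg by metis
  define N :: "(nat, 'a) automaton" where
    "N = \<lparr>states = f ` states M, transitions = (\<lambda>(p, a, q). (f p, a, f q)) ` transitions M,
          initials = f ` initials M, finals = f ` finals M\<rparr>"
  have sub: "initials M \<subseteq> states M" "finals M \<subseteq> states M"
    using M by (auto simp: finite_automaton_def)
  have tr: "p \<in> states M" "a \<in> A" "q \<in> states M" if "(p, a, q) \<in> transitions M" for p a q
    using M that by (auto simp: finite_automaton_def)
  have N_edge: "(f p, a, x) \<in> transitions N \<longleftrightarrow> (\<exists>r. x = f r \<and> (p, a, r) \<in> transitions M)"
    if "p \<in> states M" for p a x
  proof
    assume "(f p, a, x) \<in> transitions N"
    then obtain p' r where e: "(p', a, r) \<in> transitions M" "f p = f p'" "x = f r"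
      by (auto simp: N_def)
    then have "p = p'"
      using f that tr(1) by (blast dest: inj_onD)
    with e show "\<exists>r. x = f r \<and> (p, a, r) \<in> transitions M" by blast
  next
    assume "\<exists>r. x = f r \<and> (p, a, r) \<in> transitions M"
    then show "(f p, a, x) \<in> transitions N"
      by (force simp: N_def)
  qed
  have path: "path_labelled N (f p) w (f q) \<longleftrightarrow> path_labelled M p w q"
    if "p \<in> states M" "q \<in> states M" for p q w
    using that
  proof (induction w arbitrary: p)
    case Nil
    then show ?case using f by (auto simp: inj_on_def)
  next
    case (Cons a w)
    have "path_labelled N (f p) (a # w) (f q) \<longleftrightarrow>
        (\<exists>r. (p, a, r) \<in> transitions M \<and> path_labelled N (f r) w (f q))"
      using N_edge[OF Cons.prems(1)] by auto
    also have "\<dots> \<longleftrightarrow> path_labelled M p (a # w) q"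
      using Cons.IH[OF _ Cons.prems(2)] tr(3) by auto
    finally show ?case .
  qed
  have "w \<in> accepted_language N \<longleftrightarrow> w \<in> accepted_language M" for w
  proof -
    have "w \<in> accepted_language N \<longleftrightarrow>
        (\<exists>p\<in>initials M. \<exists>q\<in>finals M. path_labelled N (f p) w (f q))"
      by (simp add: accepted_language_def N_def)
    also have "\<dots> \<longleftrightarrow> w \<in> accepted_language M"
      using path sub unfolding accepted_language_def mem_Collect_eq
      by (intro bex_cong refl) (simp add: subset_iff)
    finally show ?thesis .
  qed
  then have "accepted_language N = accepted_language M"
    by blast
  moreover have "finite_automaton A N"
    using \<open>finite (states M)\<close> sub tr unfolding finite_automaton_def N_def by auto
  ultimately show ?thesis
    unfolding rational_language_def by blast
qed


section \<open>Growth of a language\<close>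

definition word_count :: "'a list set \<Rightarrow> nat \<Rightarrow> nat" where
  "word_count L l = card {w \<in> L. length w = l}"

text \<open>
  The quotients are required to be genuine eventually: since \<open>x / 0 = 0\<close>, the limit alone
  would not exclude vanishing denominators.
\<close>
definition has_local_growth_rate :: "'a list set \<Rightarrow> real \<Rightarrow> bool" where
  "has_local_growth_rate L \<gamma> \<longleftrightarrow>
     (\<forall>\<^sub>F l in sequentially. word_count L l \<noteq> 0) \<and>
     (\<lambda>l. real (word_count L (l + 1)) / real (word_count L l)) \<longlonglongrightarrow> \<gamma>"

definition generating_function :: "'a list set \<Rightarrow> rat fps" where
  "generating_function L = Abs_fps (\<lambda>l. of_nat (word_count L l))"


section \<open>Eigenvalues of a language\<close>

definition gf_decomposition ::
    "'a list set \<Rightarrow> rat poly \<Rightarrow> rat poly \<Rightarrow> rat poly \<Rightarrow> bool" where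
  "gf_decomposition L T R S \<longleftrightarrow>
     generating_function L = fps_of_poly T + fps_of_poly R / fps_of_poly S \<and>
     coprime R S \<and> degree R < degree S \<and> poly S 0 \<noteq> 0"

text \<open>
  For an infinite rational language a decomposition exists and its denominator is unique up to
  a nonzero constant factor, so the choice does not affect the eigenvalues or their
  multiplicities.
\<close>
definition gf_denominator :: "'a list set \<Rightarrow> rat poly" where
  "gf_denominator L = (SOME S. \<exists>T R. gf_decomposition L T R S)"

text \<open>\<open>reflect_poly S\<close> is the reciprocal polynomial $z^{\deg S} S(1/z)$.\<close>
definition reciprocal_polynomial :: "'a list set \<Rightarrow> complex poly" where
  "reciprocal_polynomial L = map_poly of_rat (reflect_poly (gf_denominator L))"

definition eigenvalues :: "'a list set \<Rightarrow> complex set" where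
  "eigenvalues L = {z. poly (reciprocal_polynomial L) z = 0}"

definition eigenvalue_multiplicity :: "'a list set \<Rightarrow> complex \<Rightarrow> nat" where
  "eigenvalue_multiplicity L z = order z (reciprocal_polynomial L)"

definition language_modulus :: "'a list set \<Rightarrow> real" where
  "language_modulus L = Max (cmod ` eigenvalues L)"

definition adev :: "'a list set \<Rightarrow> bool" where
  "adev L \<longleftrightarrow>
     (\<forall>z\<in>eigenvalues L.
        cmod z = language_modulus L \<and> z \<noteq> complex_of_real (language_modulus L) \<longrightarrow>
        eigenvalue_multiplicity L z
          < eigenvalue_multiplicity L (complex_of_real (language_modulus L)))"

end

theory Submission
  imports Defs "HOL-Computational_Algebra.Field_as_Ring"
begin

text \<open>
  Let $u_l$ be the number of words of length $l$. The generating function is rational with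
  denominator a constant multiple of $\prod_z (1 - zX)^{m_z}$, where $z$ runs through the
  eigenvalues and $m_z$ is the multiplicity of $z$. Let $\rho$ be the modulus, $n + 1$ the largest
  multiplicity that occurs among the eigenvalues of modulus $\rho$, and $J$ the set of
  eigenvalues of modulus $\rho$ with multiplicity exactly $n + 1$. Partial fractions show
  (\<open>rational_fps_coefficient_asymptotic\<close>) that
  $$u_l = l^n \rho^l \Bigl(\sum_{z \in J} c_z (z/\rho)^l + o(1)\Bigr), \qquad c_z \neq 0.$$
  The coefficients are nonzero because numerator and denominator are coprime.

  Both sides of the equivalence say that $J = \{\rho\}$. For the property of being adev this holds
  by definition, since a number of positive multiplicity is an eigenvalue. If $J = \{\rho\}$, then
  $u_l \sim c\, l^n \rho^l$ and the quotients $u_{l+1}/u_l$ tend to $\rho$ (\<open>single_term_imp_ratio_tendsto\<close>). Conversely, if they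
  tend to some $\gamma$, then $\sum_{z \in J} c_z (z - \gamma) (z/\rho)^l \to 0$. An exponential
  sum with distinct frequencies on the unit circle tends to $0$ only if all its coefficients
  vanish (\<open>exponential_sum_tendsto_zero\<close>), so $z = \gamma$ for all $z \in J$, and $\gamma \ge 0$
  forces $\gamma = \rho$ (\<open>ratio_tendsto_imp_single_term\<close>).
\<close>

section \<open>Generating functions of rational languages are rational\<close>

text \<open>
  The condition on \<open>q\<close> makes it a unit among the power series, so the equation says $f = p/q$.
\<close>
definition rational_fps :: "'a::field fps \<Rightarrow> bool" where
  "rational_fps f \<longleftrightarrow> (\<exists>p q. poly q 0 \<noteq> 0 \<and> f * fps_of_poly q = fps_of_poly p)"

lemma rational_fps_poly: "rational_fps (fps_of_poly p)"
  unfolding rational_fps_def by (intro exI[of _ p] exI[of _ 1]) simp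

lemma rational_fps_const: "rational_fps (fps_const c)"
  by (metis rational_fps_poly fps_of_poly_const)

lemma rational_fps_X: "rational_fps fps_X"
  by (metis rational_fps_poly fps_of_poly_fps_X)

lemma rational_fps_add:
  assumes "rational_fps f" "rational_fps g"
  shows "rational_fps (f + g)"
proof -
  obtain p q p' q' where *: "poly q 0 \<noteq> 0" "f * fps_of_poly q = fps_of_poly p"
    "poly q' 0 \<noteq> 0" "g * fps_of_poly q' = fps_of_poly p'"
    using assms unfolding rational_fps_def by blast
  have "(f + g) * fps_of_poly (q * q') =
      (f * fps_of_poly q) * fps_of_poly q' + (g * fps_of_poly q') * fps_of_poly q"
    by (simp add: fps_of_poly_mult algebra_simps)
  also have "\<dots> = fps_of_poly (p * q' + p' * q)"
    unfolding * by (simp add: fps_of_poly_mult fps_of_poly_add)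
  finally show ?thesis
    using * unfolding rational_fps_def
    by (intro exI[of _ "p * q' + p' * q"] exI[of _ "q * q'"]) simp
qed

lemma rational_fps_mult:
  assumes "rational_fps f" "rational_fps g"
  shows "rational_fps (f * g)"
proof -
  obtain p q p' q' where *: "poly q 0 \<noteq> 0" "f * fps_of_poly q = fps_of_poly p"
    "poly q' 0 \<noteq> 0" "g * fps_of_poly q' = fps_of_poly p'"
    using assms unfolding rational_fps_def by blast
  have "(f * g) * fps_of_poly (q * q') = (f * fps_of_poly q) * (g * fps_of_poly q')"
    by (simp add: fps_of_poly_mult algebra_simps)
  also have "\<dots> = fps_of_poly (p * p')"
    unfolding * by (simp add: fps_of_poly_mult)
  finally show ?thesis
    using * unfolding rational_fps_def
    by (intro exI[of _ "p * p'"] exI[of _ "q * q'"]) simp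
qed

lemma rational_fps_sum:
  "(\<And>i. i \<in> I \<Longrightarrow> rational_fps (f i)) \<Longrightarrow> rational_fps (\<Sum>i\<in>I. f i)"
  by (induction I rule: infinite_finite_induct)
     (auto intro: rational_fps_add simp: rational_fps_const[of 0, simplified])

lemma rational_fps_inverse:
  assumes "rational_fps f" "fps_nth f 0 \<noteq> 0"
  shows "rational_fps (inverse f)"
proof -
  obtain p q where *: "poly q 0 \<noteq> 0" "f * fps_of_poly q = fps_of_poly p"
    using assms unfolding rational_fps_def by blast
  have "fps_nth (f * fps_of_poly q) 0 = fps_nth f 0 * poly q 0"
    by (simp add: poly_0_coeff_0)
  then have "poly p 0 \<noteq> 0"
    using * assms by (simp add: poly_0_coeff_0)
  moreover have "inverse f * fps_of_poly p = fps_of_poly q"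
    using assms(2) unfolding *(2)[symmetric]
    by (simp add: mult.assoc[symmetric] inverse_mult_eq_1)
  ultimately show ?thesis
    unfolding rational_fps_def by blast
qed

text \<open>
  Gaussian elimination, one unknown at a time. The pivot $1 - a_{kk}$ has constant term $1$ and
  is therefore a unit with rational inverse; substituting for $f_k$ in the other equations leaves
  coefficients that again have constant term $0$, so the elimination can go on.
\<close>
lemma rational_fps_linear_system:
  fixes f r :: "'i \<Rightarrow> 'a::field fps" and a :: "'i \<Rightarrow> 'i \<Rightarrow> 'a fps"
  assumes "finite I"
    and "\<And>i. i \<in> I \<Longrightarrow> f i = r i + (\<Sum>j\<in>I. a i j * f j)"
    and "\<And>i. i \<in> I \<Longrightarrow> rational_fps (r i)"
    and "\<And>i j. i \<in> I \<Longrightarrow> j \<in> I \<Longrightarrow> rational_fps (a i j) \<and> fps_nth (a i j) 0 = 0"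
    and "i \<in> I"
  shows "rational_fps (f i)"
  using assms
proof (induction I arbitrary: r a i rule: finite_induct)
  case empty
  then show ?case by simp
next
  case (insert k I)
  define g where "g = inverse (1 - a k k)"
  have akk: "rational_fps (a k k)" "fps_nth (a k k) 0 = 0"
    using insert.prems(3)[of k k] by auto
  have "1 - a k k = fps_const 1 + fps_const (-1) * a k k"
    by (simp flip: fps_const_neg)
  then have "rational_fps (1 - a k k)"
    by (metis rational_fps_add rational_fps_const rational_fps_mult akk(1))
  then have g: "rational_fps g"
    unfolding g_def using akk(2) by (intro rational_fps_inverse) simp_all
  have fk: "f k = g * (r k + (\<Sum>j\<in>I. a k j * f j))"
  proof -
    have "f k = r k + (a k k * f k + (\<Sum>j\<in>I. a k j * f j))"
      using insert.prems(1)[of k] insert.hyps by simp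
    then have "(1 - a k k) * f k = r k + (\<Sum>j\<in>I. a k j * f j)"
      by (simp add: algebra_simps)
    moreover have "g * (1 - a k k) = 1"
      unfolding g_def using akk(2) by (intro inverse_mult_eq_1) simp
    ultimately show ?thesis
      by (metis mult.assoc mult_1)
  qed
  have rI: "rational_fps (f j)" if "j \<in> I" for j
  proof (rule insert.IH[where r = "\<lambda>i. r i + a i k * g * r k"
        and a = "\<lambda>i j. a i j + a i k * g * a k j"])
    fix i assume i: "i \<in> I"
    have "f i = r i + (a i k * f k + (\<Sum>j\<in>I. a i j * f j))"
      using insert.prems(1)[of i] insert.hyps i by simp
    also have "\<dots> = r i + a i k * g * r k + (\<Sum>j\<in>I. (a i j + a i k * g * a k j) * f j)"
      unfolding fk by (simp add: algebra_simps sum.distrib sum_distrib_left)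
    finally show "f i = \<dots>" .
    show "rational_fps (r i + a i k * g * r k)"
      using i g insert.prems by (intro rational_fps_add rational_fps_mult) auto
  next
    fix i j assume ij: "i \<in> I" "j \<in> I"
    have "rational_fps (a i j + a i k * g * a k j)"
      using ij g insert.prems by (intro rational_fps_add rational_fps_mult) auto
    then show "rational_fps (a i j + a i k * g * a k j) \<and> fps_nth (a i j + a i k * g * a k j) 0 = 0"
      using insert.prems(3) ij by simp
  qed (fact that)
  have "rational_fps (f k)"
    unfolding fk using g insert.prems rI
    by (intro rational_fps_mult rational_fps_add rational_fps_sum) auto
  with rI insert.prems(4) show ?case by auto
qed

lemma finite_automaton_path_lists:
  assumes "finite_automaton A M" "path_labelled M p w q"
  shows "w \<in> lists A"
  using assms(2)
proof (induction w arbitrary: p)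
  case (Cons a w)
  then show ?case using assms(1) unfolding finite_automaton_def by auto
qed simp

lemma rational_language_subset_lists: "rational_language A L \<Longrightarrow> L \<subseteq> lists A"
  unfolding rational_language_def accepted_language_def
  using finite_automaton_path_lists by fastforce

lemma finite_words_of_length:
  assumes "finite A" "L \<subseteq> lists A"
  shows "finite {w \<in> L. length w = l}"
  using assms by (intro finite_subset[OF _ finite_lists_length_eq[of A l]]) auto

text \<open>
  Sorting words by their first letter: the recursion behind the linear system for the generating
  functions of a rational language.
\<close>
lemma word_count_Suc:
  assumes "finite A" "L \<subseteq> lists A"
  shows "word_count L (Suc l) = (\<Sum>a\<in>A. word_count {w. a # w \<in> L} l)"
proof -
  let ?B = "\<lambda>a. {w \<in> {w. a # w \<in> L}. length w = l}"
  have "{w \<in> L. length w = Suc l} = (\<Union>a\<in>A. Cons a ` ?B a)"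
    using assms(2) by (auto simp: length_Suc_conv image_iff)
  moreover have "finite (?B a)" for a
    using assms by (intro finite_words_of_length[OF assms(1)]) auto
  ultimately have "word_count L (Suc l) = (\<Sum>a\<in>A. card (Cons a ` ?B a))"
    unfolding word_count_def using assms(1) by (auto intro!: card_UN_disjoint)
  also have "\<dots> = (\<Sum>a\<in>A. word_count {w. a # w \<in> L} l)"
    unfolding word_count_def by (intro sum.cong refl card_image) simp
  finally show ?thesis .
qed

text \<open>
  Counting paths of a nondeterministic automaton would count words with multiplicity. Instead,
  the unknowns are the generating functions of the languages \<open>K Q\<close> accepted from a \<^emph>\<open>set\<close> \<open>Q\<close> of
  states: removing a first letter leads from \<open>K Q\<close> to \<open>K (step Q a)\<close>, and each letter contributes
  a factor \<open>fps_X\<close>. The result is a finite linear system of the kind solved above.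
\<close>
lemma rational_fps_generating_function:
  assumes "finite A" "rational_language A L"
  shows "rational_fps (generating_function L)"
proof -
  obtain M :: "(nat, 'a) automaton" where M: "finite_automaton A M" "accepted_language M = L"
    using assms(2) unfolding rational_language_def by blast
  define K where "K Q = {w. \<exists>p\<in>Q. \<exists>q\<in>finals M. path_labelled M p w q}" for Q
  define step where "step Q a = {r. \<exists>p\<in>Q. (p, a, r) \<in> transitions M}" for Q a
  define c :: "nat set \<Rightarrow> nat set \<Rightarrow> rat fps" where
    "c Q Q' = (\<Sum>a\<in>A. if step Q a = Q' then fps_X else 0)" for Q Q'
  have K_lists: "K Q \<subseteq> lists A" for Q
    unfolding K_def using finite_automaton_path_lists[OF M(1)] by blast
  have K_step: "{w. a # w \<in> K Q} = K (step Q a)" for Q a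
    unfolding K_def step_def by auto
  have step_states: "step Q a \<in> Pow (states M)" for Q a
    using M(1) unfolding step_def finite_automaton_def by auto
  have fin: "finite (Pow (states M))"
    using M(1) unfolding finite_automaton_def by simp
  have eq: "generating_function (K Q) = fps_const (of_nat (word_count (K Q) 0)) +
      (\<Sum>Q'\<in>Pow (states M). c Q Q' * generating_function (K Q'))" for Q
  proof -
    have "(\<Sum>Q'\<in>Pow (states M). c Q Q' * generating_function (K Q')) =
        (\<Sum>a\<in>A. \<Sum>Q'\<in>Pow (states M).
          if Q' = step Q a then fps_X * generating_function (K Q') else 0)"
      unfolding c_def sum_distrib_right
      by (subst sum.swap) (intro sum.cong refl, auto)
    also have "\<dots> = (\<Sum>a\<in>A. fps_X * generating_function (K (step Q a)))"
      using step_states fin by (intro sum.cong refl) (simp add: sum.delta)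
    finally have 1: "(\<Sum>Q'\<in>Pow (states M). c Q Q' * generating_function (K Q')) = \<dots>" .
    show ?thesis
    proof (rule fps_ext)
      fix n
      show "fps_nth (generating_function (K Q)) n = fps_nth (fps_const (of_nat (word_count (K Q) 0)) +
      (\<Sum>Q'\<in>Pow (states M). c Q Q' * generating_function (K Q'))) n"
        unfolding 1 by (cases n)
          (simp_all add: generating_function_def fps_sum_nth word_count_Suc[OF assms(1) K_lists] K_step)
    qed
  qed
  have "rational_fps (generating_function (K Q))" if "Q \<in> Pow (states M)" for Q
  proof (rule rational_fps_linear_system[OF fin, of "\<lambda>Q. generating_function (K Q)", OF eq])
    show "rational_fps (c i j) \<and> fps_nth (c i j) 0 = 0" for i j
      unfolding c_def
      by (auto simp: fps_sum_nth intro!: rational_fps_sum rational_fps_X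
          rational_fps_const[of 0, simplified] sum.neutral)
  qed (use that rational_fps_const in auto)
  moreover have "L = K (initials M)"
    using M(2) unfolding accepted_language_def K_def by simp
  ultimately show ?thesis
    using M(1) unfolding finite_automaton_def by auto
qed

lemma word_count_not_eventually_zero:
  assumes "finite A" "L \<subseteq> lists A" "infinite L"
  shows "\<exists>l\<ge>N. word_count L l \<noteq> 0"
proof (rule ccontr)
  assume "\<not> ?thesis"
  then have "L \<subseteq> (\<Union>l<N. {w \<in> L. length w = l})"
    using finite_words_of_length[OF assms(1,2)] unfolding word_count_def
    by (auto simp: not_le[symmetric])
  then show False
    using finite_words_of_length[OF assms(1,2)] assms(3) by (meson finite_UN_I finite_lessThan finite_subset)
qed

text \<open>
  Cancel the greatest common divisor of numerator and denominator, then divide with remainder.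
  The remainder is nonzero because an infinite language over a finite alphabet contains
  arbitrarily long words, whereas a polynomial has only finitely many nonzero coefficients; this
  also makes the degree of the denominator positive.
\<close>
lemma gf_decomposition_exists:
  assumes "finite A" "rational_language A L" "infinite L"
  shows "\<exists>T R S. gf_decomposition L T R S"
proof -
  obtain p q where pq: "poly q 0 \<noteq> 0" "generating_function L * fps_of_poly q = fps_of_poly p"
    using rational_fps_generating_function[OF assms(1,2)] unfolding rational_fps_def by blast
  define d where "d = gcd p q"
  have "q \<noteq> 0" using pq by auto
  then have "d \<noteq> 0" by (simp add: d_def)
  obtain p' S where d: "p = p' * d" "q = S * d" "coprime p' S"
    using gcd_coprime_exists[of p q] \<open>d \<noteq> 0\<close> unfolding d_def by blast
  have S0: "poly S 0 \<noteq> 0" using pq d by auto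
  have "generating_function L * fps_of_poly S * fps_of_poly d = fps_of_poly p' * fps_of_poly d"
    using pq(2) unfolding d by (simp add: fps_of_poly_mult mult.assoc)
  then have gS: "generating_function L * fps_of_poly S = fps_of_poly p'"
    using \<open>d \<noteq> 0\<close> by simp
  define T where "T = p' div S"
  define R where "R = p' mod S"
  have p': "p' = T * S + R" by (simp add: T_def R_def)
  have S0': "fps_nth (fps_of_poly S) 0 \<noteq> 0" using S0 by (simp add: poly_0_coeff_0)
  have cop: "coprime R S"
    using d(3) \<open>poly S 0 \<noteq> 0\<close> unfolding R_def by (subst coprime_mod_left_iff) auto
  have inv: "fps_of_poly S * inverse (fps_of_poly S) = 1"
    using S0' by (subst mult.commute) (rule inverse_mult_eq_1)
  have "generating_function L = generating_function L * fps_of_poly S * inverse (fps_of_poly S)"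
    by (simp add: mult.assoc inv)
  also have "\<dots> = fps_of_poly T * (fps_of_poly S * inverse (fps_of_poly S)) + fps_of_poly R * inverse (fps_of_poly S)"
    unfolding gS p' by (simp add: fps_of_poly_add fps_of_poly_mult algebra_simps)
  also have "\<dots> = fps_of_poly T + fps_of_poly R / fps_of_poly S"
    using S0' inv by (simp add: fps_divide_unit)
  finally have g: "generating_function L = \<dots>" .
  have "R \<noteq> 0"
  proof
    assume "R = 0"
    then have "generating_function L = fps_of_poly T" using g by simp
    then have "of_nat (word_count L l) = coeff T l" for l
      by (metis generating_function_def fps_nth_Abs_fps fps_of_poly_nth)
    moreover obtain l where "l \<ge> Suc (degree T)" "word_count L l \<noteq> 0"
      using word_count_not_eventually_zero[OF assms(1) rational_language_subset_lists[OF assms(2)] assms(3)] by blast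
    ultimately show False
      by (metis Suc_le_lessD coeff_eq_0 of_nat_eq_0_iff)
  qed
  then have "degree R < degree S"
    using S0 degree_mod_less[of S p'] unfolding R_def by fastforce
  with g cop S0 show ?thesis
    unfolding gf_decomposition_def by blast
qed

section \<open>Coefficients of rational power series\<close>

lemma choose_asymptotic: "(\<lambda>l. real ((n + l) choose n) / real l ^ n) \<longlonglongrightarrow> 1 / fact n"
proof (induction n)
  case (Suc n)
  have "(\<lambda>l. real (Suc n) / real l + 1) \<longlonglongrightarrow> 0 + 1"
    by (intro tendsto_intros lim_const_over_n)
  from tendsto_mult[OF Suc.IH tendsto_divide[OF this tendsto_const[of "real (Suc n)"]]]
  have "(\<lambda>l. real ((n + l) choose n) / real l ^ n * ((real (Suc n) / real l + 1) / real (Suc n)))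
      \<longlonglongrightarrow> 1 / fact (Suc n)"
    by (simp add: field_simps)
  moreover have "\<forall>\<^sub>F l in sequentially.
      real ((n + l) choose n) / real l ^ n * ((real (Suc n) / real l + 1) / real (Suc n)) =
      real ((Suc n + l) choose Suc n) / real l ^ Suc n"
    using eventually_gt_at_top[of 0]
  proof eventually_elim
    case (elim l)
    have "real (Suc (n + l)) * real ((n + l) choose n) = real (Suc (n + l) choose Suc n) * real (Suc n)"
      using Suc_times_binomial_eq[of "n + l" n] by (metis of_nat_mult)
    then have *: "real ((Suc n + l) choose Suc n) =
        real (Suc (n + l)) * real ((n + l) choose n) / real (Suc n)"
      by (simp add: field_simps del: binomial_Suc_Suc)
    show ?case
      unfolding * using elim by (simp add: field_simps)
  qed
  ultimately show ?case
    by (rule Lim_transform_eventually)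
qed simp

lemma power_times_geometric_tendsto_zero:
  fixes q :: real
  assumes "0 \<le> q" "q < 1"
  shows "(\<lambda>l. real l ^ j * q ^ l) \<longlonglongrightarrow> 0"
proof (cases "j = 0")
  case True
  then show ?thesis using assms by (simp add: LIMSEQ_power_zero)
next
  case False
  define r where "r = root j q"
  have r: "r ^ j = q" "norm r < 1"
    using False assms by (auto simp: r_def real_root_lt_1_iff)
  have "(\<lambda>l. (of_nat l * r ^ l) ^ j) \<longlonglongrightarrow> 0 ^ j"
    by (intro tendsto_power powser_times_n_limit_0 r)
  moreover have "(of_nat l * r ^ l) ^ j = real l ^ j * q ^ l" for l
    unfolding r(1)[symmetric] by (simp add: power_mult_distrib mult.commute flip: power_mult)
  ultimately show ?thesis using False by (simp add: power_0_left)
qed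

text \<open>
  The coefficients of $(1 - kX)^{-(j+1)}$ are $\binom{j+l}{j} k^l \sim l^j k^l / j!$. Measured against
  $l^n \rho^l$ they vanish in the limit, unless $k$ has the full modulus $\rho$ and the full
  multiplicity $n + 1$.
\<close>
lemma negative_power_coefficient_asymptotic:
  fixes k :: complex
  assumes \<rho>: "\<rho> > 0" and k: "cmod k \<le> \<rho>" "cmod k = \<rho> \<Longrightarrow> j \<le> n"
  shows "(\<lambda>l. of_nat ((j + l) choose j) * k ^ l / of_real (real l ^ n * \<rho> ^ l)
     - (if cmod k = \<rho> \<and> j = n then 1 / fact n * (k / of_real \<rho>) ^ l else 0)) \<longlonglongrightarrow> 0"
proof -
  define b where "b l = real ((j + l) choose j) / real l ^ j" for l
  have b: "b \<longlonglongrightarrow> 1 / fact j" unfolding b_def by (rule choose_asymptotic)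
  have split: "of_nat ((j + l) choose j) * k ^ l / of_real (real l ^ n * \<rho> ^ l) =
      of_real (b l) * (of_real (real l ^ j / real l ^ n) * (k / of_real \<rho>) ^ l)" if "l > 0" for l
    using that \<rho> by (simp add: b_def field_simps)
  show ?thesis
  proof (cases "cmod k = \<rho> \<and> j = n")
    case True
    have "(\<lambda>l. (b l - 1 / fact n)) \<longlonglongrightarrow> 0"
      using LIM_zero[OF b] True by simp
    then have "(\<lambda>l. of_real (b l - 1 / fact n) * (k / of_real \<rho>) ^ l) \<longlonglongrightarrow> 0"
      by (rule tendsto_0_le[where K = 1])
         (use True \<rho> in \<open>simp add: norm_mult norm_power norm_divide flip: of_real_diff\<close>)
    moreover have "\<forall>\<^sub>F l in sequentially. of_real (b l - 1 / fact n) * (k / of_real \<rho>) ^ l =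
      of_nat ((j + l) choose j) * k ^ l / of_real (real l ^ n * \<rho> ^ l)
        - (if cmod k = \<rho> \<and> j = n then 1 / fact n * (k / of_real \<rho>) ^ l else 0)"
      using eventually_gt_at_top[of 0]
    proof eventually_elim
      case (elim l)
      show ?case
        unfolding split[OF elim] using True elim by (simp add: algebra_simps)
    qed
    ultimately show ?thesis by (rule Lim_transform_eventually)
  next
    case False
    have e: "(\<lambda>l. of_real (real l ^ j / real l ^ n) * (k / of_real \<rho>) ^ l) \<longlonglongrightarrow> 0"
    proof (cases "cmod k = \<rho>")
      case True
      then have "j < n" using False k(2) by simp
      show ?thesis
      proof (rule tendsto_0_le[where K = 1, OF lim_1_over_n])
        show "\<forall>\<^sub>F l in sequentially. norm (of_real (real l ^ j / real l ^ n) * (k / of_real \<rho>) ^ l)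
          \<le> norm (1 / of_nat l :: real) * 1"
          using eventually_gt_at_top[of 0]
        proof eventually_elim
          case (elim l)
          have "real l ^ Suc j \<le> real l ^ n"
            using elim \<open>j < n\<close> by (intro power_increasing) auto
          then have "real l ^ j / real l ^ n \<le> 1 / real l"
            using elim by (simp add: field_simps)
          then show ?case
            using True \<rho> elim by (simp add: norm_mult norm_power norm_divide)
        qed
      qed
    next
      case False
      define q where "q = cmod k / \<rho>"
      have q: "0 \<le> q" "q < 1" using False k(1) \<rho> by (auto simp: q_def)
      show ?thesis
      proof (rule tendsto_0_le[where K = 1, OF power_times_geometric_tendsto_zero[OF q]])
        show "\<forall>\<^sub>F l in sequentially. norm (of_real (real l ^ j / real l ^ n) * (k / of_real \<rho>) ^ l)
          \<le> norm (real l ^ j * q ^ l) * 1"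
          using eventually_gt_at_top[of 0]
        proof eventually_elim
          case (elim l)
          have "real l ^ j / real l ^ n \<le> real l ^ j / 1"
            using elim by (intro divide_left_mono) auto
          then have "real l ^ j / real l ^ n * q ^ l \<le> real l ^ j * q ^ l"
            using q by (intro mult_right_mono) auto
          then show ?case
            using \<rho> q by (simp add: norm_mult norm_power norm_divide q_def)
        qed
      qed
    qed
    have "(\<lambda>l. of_real (b l) * (of_real (real l ^ j / real l ^ n) * (k / of_real \<rho>) ^ l))
        \<longlonglongrightarrow> of_real (1 / fact j) * 0"
      by (intro tendsto_mult tendsto_of_real b e)
    then have "(\<lambda>l. of_real (b l) * (of_real (real l ^ j / real l ^ n) * (k / of_real \<rho>) ^ l))
        \<longlonglongrightarrow> 0" by simp
    moreover have "\<forall>\<^sub>F l in sequentially.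
        of_real (b l) * (of_real (real l ^ j / real l ^ n) * (k / of_real \<rho>) ^ l) =
        of_nat ((j + l) choose j) * k ^ l / of_real (real l ^ n * \<rho> ^ l)
        - (if cmod k = \<rho> \<and> j = n then 1 / fact n * (k / of_real \<rho>) ^ l else 0)"
      using eventually_gt_at_top[of 0]
    proof eventually_elim
      case (elim l)
      show ?case
        unfolding split[OF elim] using False by auto
    qed
    ultimately show ?thesis by (rule Lim_transform_eventually)
  qed
qed

lemma fps_negative_power_linear:
  fixes k :: "'a::field_char_0"
  shows "Abs_fps (\<lambda>l. of_nat ((j + l) choose j) * k ^ l) * fps_of_poly ([:1, -k:] ^ Suc j) = 1"
proof -
  have "(j + l) choose l = (j + l) choose j" for l
    using binomial_symmetric[of j "j + l"] by simp
  then have "Abs_fps (\<lambda>l. of_nat ((j + l) choose j) * k ^ l) =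
      inverse ((1 - fps_const k * fps_X) ^ Suc j)"
    by (subst one_minus_const_fps_X_neg_power') simp_all
  moreover have "fps_of_poly ([:1, -k:] ^ Suc j) = (1 - fps_const k * fps_X) ^ Suc j"
    unfolding fps_of_poly_power by (subst fps_of_poly_linear') (simp flip: fps_const_neg)
  moreover have "inverse ((1 - fps_const k * fps_X) ^ Suc j) * (1 - fps_const k * fps_X) ^ Suc j = 1"
    by (intro inverse_mult_eq_1) (simp add: fps_power_zeroth del: power_Suc)
  ultimately show ?thesis by (simp only:)
qed

text \<open>
  This is partial fraction decomposition, done one pole order at a time and keeping track only of
  the leading terms. Let \<open>k\<close> have multiplicity $j + 1$, and let $S$ be the product of the factors of
  the other elements of \<open>E\<close>. Subtracting $c_0 / (1 - kX)^{j+1}$ with $c_0 = N(1/k) / S(1/k)$ makes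
  the new numerator $N - c_0 S$ vanish at $1/k$, so a factor $1 - kX$ cancels and the multiplicity
  of \<open>k\<close> drops by one.

  At every other $z$ of positive multiplicity, $S(1/z) = 0$, so that the new numerator is nonzero
  at $1/z$ if the old one was. This is why the coefficients of all dominant terms are nonzero
  when \<open>N\<close> and the denominator have no common root.
\<close>
lemma rational_fps_coefficient_asymptotic:
  fixes E :: "complex set" and a :: "complex fps" and m :: "complex \<Rightarrow> nat"
  assumes E: "finite E" "0 \<notin> E" and \<rho>: "\<rho> > 0"
    and a: "a * fps_of_poly (\<Prod>z\<in>E. [:1, -z:] ^ m z) = fps_of_poly N"
    and dom: "\<And>z. z \<in> E \<Longrightarrow> cmod z \<le> \<rho> \<and> (cmod z = \<rho> \<longrightarrow> m z \<le> Suc n)"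
  shows "\<exists>c. (\<forall>z\<in>{z\<in>E. cmod z = \<rho> \<and> m z = Suc n}. poly N (1 / z) \<noteq> 0 \<longrightarrow> c z \<noteq> 0) \<and>
    (\<lambda>l. fps_nth a l / of_real (real l ^ n * \<rho> ^ l)
       - (\<Sum>z\<in>{z\<in>E. cmod z = \<rho> \<and> m z = Suc n}. c z * (z / of_real \<rho>) ^ l)) \<longlonglongrightarrow> 0"
  using a dom
proof (induction "\<Sum>z\<in>E. m z" arbitrary: m a N)
  case 0
  then have m0: "m z = 0" if "z \<in> E" for z
    using that E by simp
  then have "a = fps_of_poly N"
    using "0.prems"(1) by simp
  have "\<forall>\<^sub>F l in sequentially. 0 = fps_nth a l / of_real (real l ^ n * \<rho> ^ l)"
    using eventually_gt_at_top[of "degree N"]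
    by eventually_elim (simp add: \<open>a = fps_of_poly N\<close> coeff_eq_0)
  then have "(\<lambda>l. fps_nth a l / of_real (real l ^ n * \<rho> ^ l)) \<longlonglongrightarrow> 0"
    by (rule Lim_transform_eventually[OF tendsto_const])
  moreover have "{z\<in>E. cmod z = \<rho> \<and> m z = Suc n} = {}"
    using m0 by auto
  ultimately show ?case by (simp only:) simp
next
  case (Suc s)
  obtain k where k: "k \<in> E" "m k \<noteq> 0"
    using Suc.hyps(2) by (metis nat.distinct(1) sum.neutral)
  then obtain j where j: "m k = Suc j" using not0_implies_Suc by blast
  define m' where "m' = m(k := j)"
  define S where "S = (\<Prod>z\<in>E - {k}. [:1, -z:] ^ m z)"
  have k0: "k \<noteq> 0" using k E by auto
  have Sk: "poly S (1 / k) \<noteq> 0"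
    using E k0 by (auto simp: S_def poly_prod)
  have prod_m: "(\<Prod>z\<in>E. [:1, -z:] ^ m z) = [:1, -k:] ^ Suc j * S"
    using E k j by (simp add: S_def prod.remove)
  have prod_m': "(\<Prod>z\<in>E. [:1, -z:] ^ m' z) = [:1, -k:] ^ j * S"
    using E k by (simp add: S_def prod.remove m'_def)
  define c0 where "c0 = poly N (1 / k) / poly S (1 / k)"
  have "poly (N - smult c0 S) (1 / k) = 0"
    using Sk by (simp add: c0_def)
  then obtain N2 where "N - smult c0 S = [:- (1 / k), 1:] * N2"
    unfolding poly_eq_0_iff_dvd by (auto elim: dvdE)
  moreover have "[:- (1 / k), 1:] = smult (- (1 / k)) [:1, -k:]"
    using k0 by simp
  ultimately have "\<exists>N1. N - smult c0 S = [:1, -k:] * N1"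
    by (metis mult_smult_left mult_smult_right)
  then obtain N1 where N1: "N - smult c0 S = [:1, -k:] * N1" by blast
  define G where "G = Abs_fps (\<lambda>l. of_nat ((j + l) choose j) * k ^ l)"
  define b where "b = a - fps_const c0 * G"
  have "b * fps_of_poly ([:1, -k:] ^ Suc j * S) =
      a * fps_of_poly ([:1, -k:] ^ Suc j * S)
        - fps_const c0 * (G * fps_of_poly ([:1, -k:] ^ Suc j)) * fps_of_poly S"
    by (simp only: b_def left_diff_distrib fps_of_poly_mult mult.assoc)
  also have "\<dots> = fps_of_poly (N - smult c0 S)"
    using Suc.prems(1) unfolding prod_m G_def fps_negative_power_linear
    by (simp add: fps_of_poly_diff fps_of_poly_smult)
  finally have "b * fps_of_poly ([:1, -k:] ^ j * S) * fps_of_poly [:1, -k:]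
      = fps_of_poly N1 * fps_of_poly [:1, -k:]"
    unfolding N1 by (simp only: fps_of_poly_mult power_Suc mult_ac)
  moreover have "fps_of_poly [:1, -k:] \<noteq> 0"
    by (simp only: fps_of_poly_eq_iff flip: fps_of_poly_0) simp
  ultimately have b: "b * fps_of_poly (\<Prod>z\<in>E. [:1, -z:] ^ m' z) = fps_of_poly N1"
    unfolding prod_m' by simp
  have "(\<Sum>z\<in>E. m z) = Suc (\<Sum>z\<in>E. m' z)"
    using E k j by (simp add: sum.remove m'_def)
  then have s: "s = (\<Sum>z\<in>E. m' z)" using Suc.hyps(2) by simp
  have dom': "cmod z \<le> \<rho> \<and> (cmod z = \<rho> \<longrightarrow> m' z \<le> Suc n)" if "z \<in> E" for z
    using Suc.prems(2)[OF that] j by (auto simp: m'_def)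
  let ?J = "{z\<in>E. cmod z = \<rho> \<and> m z = Suc n}" and ?J' = "{z\<in>E. cmod z = \<rho> \<and> m' z = Suc n}"
  obtain c where c: "\<forall>z\<in>?J'. poly N1 (1 / z) \<noteq> 0 \<longrightarrow> c z \<noteq> 0"
    and lim: "(\<lambda>l. fps_nth b l / of_real (real l ^ n * \<rho> ^ l)
       - (\<Sum>z\<in>?J'. c z * (z / of_real \<rho>) ^ l)) \<longlonglongrightarrow> 0"
    using Suc.hyps(1)[OF s b dom'] by blast
  \<comment> \<open>After its multiplicity has dropped, \<open>k\<close> is no longer dominant, so its coefficient may be set freely.\<close>
  have kJ': "k \<notin> ?J'"
    using Suc.prems(2)[OF k(1)] j by (auto simp: m'_def)
  have J: "?J = (if cmod k = \<rho> \<and> j = n then insert k ?J' else ?J')"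
    using k(1) j kJ' by (auto simp: m'_def)
  define c' where "c' = c(k := c0 / fact n)"
  have sum_c': "(\<Sum>z\<in>?J. c' z * (z / of_real \<rho>) ^ l) = (\<Sum>z\<in>?J'. c z * (z / of_real \<rho>) ^ l) +
      c0 * (if cmod k = \<rho> \<and> j = n then 1 / fact n * (k / of_real \<rho>) ^ l else 0)" for l
  proof -
    have "(\<Sum>z\<in>?J'. c' z * (z / of_real \<rho>) ^ l) = (\<Sum>z\<in>?J'. c z * (z / of_real \<rho>) ^ l)"
      using kJ' by (intro sum.cong refl) (auto simp: c'_def)
    then show ?thesis
      unfolding J using kJ' E(1) by (simp add: c'_def del: mem_Collect_eq)
  qed
  show ?case
  proof (intro exI[of _ c'] conjI ballI impI)
    fix z assume z: "z \<in> ?J" "poly N (1 / z) \<noteq> 0"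
    show "c' z \<noteq> 0"
    proof (cases "z = k")
      case True
      then show ?thesis using z Sk by (simp add: c'_def c0_def)
    next
      case False
      have "z \<noteq> 0" using z E by auto
      then have "poly S (1 / z) = 0"
        using z False E by (auto simp: S_def poly_prod)
      then have "poly N (1 / z) = poly ([:1, -k:] * N1) (1 / z)"
        unfolding N1[symmetric] by simp
      then have "poly N1 (1 / z) \<noteq> 0"
        using z(2) by auto
      then show ?thesis
        using c z False by (simp add: c'_def m'_def)
    qed
  next
    have kn: "cmod k \<le> \<rho>" "cmod k = \<rho> \<Longrightarrow> j \<le> n"
      using Suc.prems(2)[OF k(1)] j by auto
    from tendsto_add[OF lim tendsto_mult_left[OF negative_power_coefficient_asymptotic[OF \<rho> kn], of c0]]
    have *: "(\<lambda>l. (fps_nth b l / of_real (real l ^ n * \<rho> ^ l) - (\<Sum>z\<in>?J'. c z * (z / of_real \<rho>) ^ l)) +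
        c0 * (fps_nth G l / of_real (real l ^ n * \<rho> ^ l)
          - (if cmod k = \<rho> \<and> j = n then 1 / fact n * (k / of_real \<rho>) ^ l else 0))) \<longlonglongrightarrow> 0"
      by (simp add: G_def)
    show "(\<lambda>l. fps_nth a l / of_real (real l ^ n * \<rho> ^ l)
         - (\<Sum>z\<in>?J. c' z * (z / of_real \<rho>) ^ l)) \<longlonglongrightarrow> 0"
      unfolding sum_c'
      by (rule Lim_transform_eventually[OF *], rule always_eventually)
         (simp add: b_def right_diff_distrib diff_divide_distrib)
  qed
qed

section \<open>Convergence of quotients and exponential sums\<close>

text \<open>
  Induction on the number of frequencies: the difference operator $s_l \mapsto s_{l+1} - w_k s_l$
  preserves convergence to $0$, removes the frequency $w_k$ and multiplies every other coefficient
  $c_i$ by $w_i - w_k \neq 0$. Once a single term $c_k w_k^l$ is left, its constant modulus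
  $|c_k|$ must be $0$.
\<close>
lemma exponential_sum_tendsto_zero:
  fixes c w :: "'i \<Rightarrow> complex"
  assumes "finite J" "inj_on w J" "\<And>i. i \<in> J \<Longrightarrow> cmod (w i) = 1"
    and "(\<lambda>l. \<Sum>i\<in>J. c i * w i ^ l) \<longlonglongrightarrow> 0" "i \<in> J"
  shows "c i = 0"
  using assms
proof (induction J arbitrary: c i rule: finite_induct)
  case empty
  then show ?case by simp
next
  case (insert k J)
  let ?s = "\<lambda>l. \<Sum>i\<in>insert k J. c i * w i ^ l"
  have "(\<lambda>l. ?s (Suc l) - w k * ?s l) \<longlonglongrightarrow> 0 - w k * 0"
    by (intro tendsto_intros insert.prems(3) LIMSEQ_Suc)
  moreover have "?s (Suc l) - w k * ?s l = (\<Sum>i\<in>J. (c i * (w i - w k)) * w i ^ l)" for l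
    using insert.hyps by (simp add: algebra_simps sum_distrib_left sum_subtractf)
  ultimately have "(\<lambda>l. \<Sum>i\<in>J. (c i * (w i - w k)) * w i ^ l) \<longlonglongrightarrow> 0"
    by simp
  then have "c i * (w i - w k) = 0" if "i \<in> J" for i
    using insert.IH[where c = "\<lambda>i. c i * (w i - w k)"] insert.prems that by auto
  moreover have "w i \<noteq> w k" if "i \<in> J" for i
    using that insert.hyps insert.prems(1) unfolding inj_on_def by blast
  ultimately have cJ: "c i = 0" if "i \<in> J" for i
    using that by force
  then have "?s l = c k * w k ^ l" for l
    using insert.hyps by simp
  then have "(\<lambda>l. norm (c k * w k ^ l)) \<longlonglongrightarrow> norm (0::complex)"
    using tendsto_norm[OF insert.prems(3)] by simp
  moreover have "norm (c k * w k ^ l) = norm (c k)" for l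
    using insert.prems(2)[of k] by (simp add: norm_mult norm_power)
  ultimately have "c k = 0" by (simp add: LIMSEQ_const_iff)
  with cJ insert.prems(4) show ?case by auto
qed

lemma tendsto_Suc_ratio_power: "(\<lambda>l. real (Suc l) ^ n / real l ^ n) \<longlonglongrightarrow> 1"
proof -
  have "(\<lambda>l. (real (Suc l) / real l) ^ n) \<longlonglongrightarrow> 1 ^ n"
    by (intro tendsto_power LIMSEQ_Suc_n_over_n)
  then show ?thesis by (simp add: power_divide)
qed

text \<open>
  Write $w_l = u_l / (l^n \rho^l)$ and let $v_l$ be the exponential sum that approximates it.
  Convergence of the quotients to $\gamma$ means $u_{l+1} - \gamma u_l = o(u_l)$; since $w$ is
  bounded, this gives $\rho w_{l+1} - \gamma w_l \to 0$, and the same for $v$. But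
  $\rho v_{l+1} - \gamma v_l$ is the exponential sum with coefficients $c_z (z - \gamma)$, all of
  which must therefore vanish: every $z \in J$ equals $\gamma$, which is a nonnegative number of
  modulus $\rho$.
\<close>
lemma ratio_tendsto_imp_single_term:
  fixes u :: "nat \<Rightarrow> real" and c :: "complex \<Rightarrow> complex"
  assumes \<rho>: "\<rho> > 0" and J: "finite J" "J \<noteq> {}" "\<And>z. z \<in> J \<Longrightarrow> cmod z = \<rho> \<and> c z \<noteq> 0"
    and asym: "(\<lambda>l. of_real (u l / (real l ^ n * \<rho> ^ l)) - (\<Sum>z\<in>J. c z * (z / of_real \<rho>) ^ l)) \<longlonglongrightarrow> 0"
    and u: "\<And>l. u l \<ge> 0" "\<forall>\<^sub>F l in sequentially. u l \<noteq> 0"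
    and lim: "(\<lambda>l. u (Suc l) / u l) \<longlonglongrightarrow> \<gamma>"
  shows "J = {of_real \<rho>} \<and> \<gamma> = \<rho>"
proof -
  define w where "w l = u l / (real l ^ n * \<rho> ^ l)" for l
  define v where "v l = (\<Sum>z\<in>J. c z * (z / of_real \<rho>) ^ l)" for l
  have wv: "(\<lambda>l. of_real (w l) - v l) \<longlonglongrightarrow> 0"
    using asym unfolding w_def v_def .
  have "norm (v l) \<le> (\<Sum>z\<in>J. norm (c z))" for l
    unfolding v_def using \<rho> J(3)
    by (intro order.trans[OF norm_sum] sum_mono) (simp add: norm_mult norm_power norm_divide)
  moreover obtain K where "cmod (of_real (w l) - v l) \<le> K" for l
    using convergent_imp_Bseq[of "\<lambda>l. of_real (w l) - v l"] wv
    unfolding convergent_def Bseq_def by blast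
  ultimately have "norm (complex_of_real (w l)) \<le> K + (\<Sum>z\<in>J. norm (c z))" for l
    using norm_triangle_sub[of "complex_of_real (w l)" "v l"] add_mono
    by (metis add.commute order.trans)
  then have Bw: "\<bar>w l\<bar> \<le> K + (\<Sum>z\<in>J. norm (c z))" for l
    by (metis norm_of_real)
  define r where "r l = real (Suc l) ^ n / real l ^ n" for l
  have r: "r \<longlonglongrightarrow> 1" unfolding r_def by (rule tendsto_Suc_ratio_power)
  have "(\<lambda>l. (u (Suc l) / u l - \<gamma>) * w l) \<longlonglongrightarrow> 0"
    by (rule tendsto_0_le[OF LIM_zero[OF lim], where K = "K + (\<Sum>z\<in>J. norm (c z))"])
       (auto simp: abs_mult intro!: always_eventually mult_left_mono Bw)
  \<comment> \<open>The weights at \<open>l\<close> and \<open>Suc l\<close> differ by the factor \<open>\<rho> * r l\<close>; this term pays for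
    replacing \<open>r l\<close> by its limit 1.\<close>
  moreover have "(\<lambda>l. (1 - r l) * (\<rho> * w (Suc l))) \<longlonglongrightarrow> 0"
  proof (rule tendsto_0_le[where K = "\<rho> * (K + (\<Sum>z\<in>J. norm (c z)))"])
    show "(\<lambda>l. 1 - r l) \<longlonglongrightarrow> 0"
      using tendsto_diff[OF tendsto_const[of 1] r] by simp
    show "\<forall>\<^sub>F l in sequentially. norm ((1 - r l) * (\<rho> * w (Suc l)))
        \<le> norm (1 - r l) * (\<rho> * (K + (\<Sum>z\<in>J. norm (c z))))"
      using \<rho> by (auto simp: abs_mult intro!: always_eventually mult_left_mono Bw)
  qed
  ultimately have "(\<lambda>l. (u (Suc l) / u l - \<gamma>) * w l + (1 - r l) * (\<rho> * w (Suc l))) \<longlonglongrightarrow> 0 + 0"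
    by (rule tendsto_add)
  moreover have "\<forall>\<^sub>F l in sequentially.
      (u (Suc l) / u l - \<gamma>) * w l + (1 - r l) * (\<rho> * w (Suc l)) = \<rho> * w (Suc l) - \<gamma> * w l"
    using u(2) eventually_gt_at_top[of 0]
  proof eventually_elim
    case (elim l)
    have "u (Suc l) / u l * w l = r l * (\<rho> * w (Suc l))"
      unfolding w_def r_def using elim \<rho> by (simp add: field_simps del: of_nat_Suc)
    then show ?case by (simp add: algebra_simps)
  qed
  ultimately have "(\<lambda>l. \<rho> * w (Suc l) - \<gamma> * w l) \<longlonglongrightarrow> 0"
    by (simp add: tendsto_cong)
  from tendsto_of_real[OF this, where ?'a = complex]
  have "(\<lambda>l. of_real \<rho> * of_real (w (Suc l)) - of_real \<gamma> * complex_of_real (w l)) \<longlonglongrightarrow> 0"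
    by simp
  from tendsto_diff[OF this tendsto_diff[OF tendsto_mult_left[OF LIMSEQ_Suc[OF wv], of "of_real \<rho>"]
      tendsto_mult_left[OF wv, of "of_real \<gamma>"]]]
  have "(\<lambda>l. of_real \<rho> * v (Suc l) - of_real \<gamma> * v l) \<longlonglongrightarrow> 0"
    by (simp add: algebra_simps)
  moreover have "of_real \<rho> * v (Suc l) - of_real \<gamma> * v l =
      (\<Sum>z\<in>J. (c z * (z - of_real \<gamma>)) * (z / of_real \<rho>) ^ l)" for l
    unfolding v_def sum_distrib_left sum_subtractf[symmetric] using \<rho>
    by (intro sum.cong refl) (simp add: field_simps)
  ultimately have lim0: "(\<lambda>l. \<Sum>z\<in>J. (c z * (z - of_real \<gamma>)) * (z / of_real \<rho>) ^ l) \<longlonglongrightarrow> 0"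
    by simp
  have z: "z = of_real \<gamma>" if "z \<in> J" for z
  proof -
    have "c z * (z - of_real \<gamma>) = 0"
      using \<rho> J(3) that
      by (intro exponential_sum_tendsto_zero[OF J(1) _ _ lim0]) (auto simp: inj_on_def norm_divide)
    then show ?thesis using J(3) that by auto
  qed
  have "\<gamma> \<ge> 0"
    using lim by (rule LIMSEQ_le_const) (use u(1) in auto)
  moreover obtain z where "z \<in> J" using J(2) by blast
  ultimately have "\<gamma> = \<rho>" using z[of z] J(3)[of z] by auto
  with z J(2) show ?thesis by auto
qed

lemma single_term_imp_ratio_tendsto:
  fixes u :: "nat \<Rightarrow> real" and c :: complex
  assumes \<rho>: "\<rho> > 0" and c: "c \<noteq> 0"
    and asym: "(\<lambda>l. complex_of_real (u l / (real l ^ n * \<rho> ^ l))) \<longlonglongrightarrow> c"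
  shows "(\<forall>\<^sub>F l in sequentially. u l \<noteq> 0) \<and> (\<lambda>l. u (Suc l) / u l) \<longlonglongrightarrow> \<rho>"
proof -
  define w where "w l = u l / (real l ^ n * \<rho> ^ l)" for l
  define r where "r l = real (Suc l) ^ n / real l ^ n" for l
  have w: "(\<lambda>l. complex_of_real (w l)) \<longlonglongrightarrow> c" using asym unfolding w_def .
  have ev: "\<forall>\<^sub>F l in sequentially. u l \<noteq> 0"
    using tendsto_imp_eventually_ne[OF w c] by eventually_elim (auto simp: w_def)
  have r: "r \<longlonglongrightarrow> 1" unfolding r_def by (rule tendsto_Suc_ratio_power)
  have "(\<lambda>l. of_real \<rho> * of_real (r l) * (of_real (w (Suc l)) / of_real (w l))) \<longlonglongrightarrow>
      of_real \<rho> * of_real 1 * (c / c)"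
    by (intro tendsto_intros r LIMSEQ_Suc w c)
  moreover have "\<forall>\<^sub>F l in sequentially. of_real \<rho> * of_real (r l) * (of_real (w (Suc l)) / of_real (w l))
     = complex_of_real (u (Suc l) / u l)"
    using ev eventually_gt_at_top[of 0]
  proof eventually_elim
    case (elim l)
    have "\<rho> * r l * (w (Suc l) / w l) = u (Suc l) / u l"
      unfolding w_def r_def using elim \<rho> by (simp add: field_simps del: of_nat_Suc)
    then show ?case by (metis of_real_mult of_real_divide)
  qed
  ultimately have "(\<lambda>l. complex_of_real (u (Suc l) / u l)) \<longlonglongrightarrow> of_real \<rho>"
    using c by (simp add: tendsto_cong)
  then show ?thesis using ev by (simp only: tendsto_of_real_iff)
qed

section \<open>Eigenvalues and the local growth rate\<close>

lemma map_poly_of_rat_add: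
  "map_poly of_rat (p + q) = (map_poly of_rat p + map_poly of_rat q :: 'a::field_char_0 poly)"
  by (rule poly_eqI) (simp add: coeff_map_poly of_rat_add)

lemma map_poly_of_rat_mult:
  "map_poly of_rat (p * q) = (map_poly of_rat p * map_poly of_rat q :: 'a::field_char_0 poly)"
  by (rule poly_eqI) (simp add: coeff_map_poly coeff_mult of_rat_sum of_rat_mult)

text \<open>
  A Bezout identity over the rationals remains valid over the larger field.
\<close>
lemma coprime_map_poly_of_rat_no_common_root:
  fixes z :: "'a::field_char_0"
  assumes "coprime p q" "poly (map_poly of_rat q) z = 0"
  shows "poly (map_poly of_rat p) z \<noteq> 0"
proof
  assume z: "poly (map_poly of_rat p) z = 0"
  obtain a b where "a * p + b * q = 1"
    using bezout_coefficients_fst_snd[of p q] assms(1) by (metis coprime_iff_gcd_eq_1)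
  then have "poly (map_poly of_rat (a * p + b * q)) z = poly (map_poly of_rat 1) z"
    by simp
  then show False
    using z assms(2) by (simp add: map_poly_of_rat_add map_poly_of_rat_mult)
qed

text \<open>
  Passing to the reciprocal polynomial turns a zero $z$ of $\mathsf{P}_L$ into the factor $1 - zX$ of
  the denominator, with the same multiplicity. The whole numerator $TS + R$ is used instead of a
  separate polynomial part: it is congruent to $R$ modulo $S$, hence still coprime to $S$.
\<close>
lemma complex_generating_function_factorization:
  assumes "finite A" "rational_language A L" "infinite L"
  shows "finite (eigenvalues L)" "eigenvalues L \<noteq> {}" "0 \<notin> eigenvalues L"
    and "\<And>z. z \<in> eigenvalues L \<longleftrightarrow> eigenvalue_multiplicity L z > 0"
    and "\<exists>N. Abs_fps (\<lambda>l. of_nat (word_count L l)) *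
          fps_of_poly (\<Prod>z\<in>eigenvalues L. [:1, -z:] ^ eigenvalue_multiplicity L z) = fps_of_poly N \<and>
        (\<forall>z\<in>eigenvalues L. poly N (1 / z) \<noteq> 0)"
proof -
  define S where "S = gf_denominator L"
  have "\<exists>S T R. gf_decomposition L T R S"
    using gf_decomposition_exists[OF assms] by blast
  then have "\<exists>T R. gf_decomposition L T R S"
    unfolding S_def gf_denominator_def by (rule someI_ex)
  then obtain T R where TR: "generating_function L = fps_of_poly T + fps_of_poly R / fps_of_poly S"
     "coprime R S" "degree R < degree S" "poly S 0 \<noteq> 0"
    unfolding gf_decomposition_def by blast
  define P where "P = reciprocal_polynomial L"
  define Sc :: "complex poly" where "Sc = map_poly of_rat S"
  have Sc0: "coeff Sc 0 \<noteq> 0"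
    using TR(4) by (simp add: Sc_def coeff_map_poly poly_0_coeff_0)
  have degSc: "degree Sc = degree S"
    unfolding Sc_def by (rule degree_map_poly) simp
  have P: "P = reflect_poly Sc"
    by (rule poly_eqI) (simp add: P_def reciprocal_polynomial_def S_def[symmetric] coeff_map_poly
        coeff_reflect_poly degSc, simp add: Sc_def coeff_map_poly)
  have P_nz: "P \<noteq> 0" using Sc0 unfolding P by auto
  have degP: "degree P = degree S"
    unfolding P using Sc0 degSc by simp
  have E: "eigenvalues L = {z. poly P z = 0}"
    unfolding eigenvalues_def P_def by simp
  show "finite (eigenvalues L)"
    unfolding E using P_nz by (rule poly_roots_finite)
  show "eigenvalues L \<noteq> {}"
  proof -
    have "\<not> constant (poly P)"
      using degP TR(3) by (simp add: constant_degree)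
    then show ?thesis
      unfolding E using fundamental_theorem_of_algebra by blast
  qed
  have "coeff P 0 \<noteq> 0"
    unfolding P using Sc0 by (auto simp: leading_coeff_0_iff)
  then show E0: "0 \<notin> eigenvalues L"
    unfolding E by (simp add: poly_0_coeff_0)
  show "z \<in> eigenvalues L \<longleftrightarrow> eigenvalue_multiplicity L z > 0" for z
    unfolding E eigenvalue_multiplicity_def P_def[symmetric] using P_nz by (simp add: order_root)
  let ?Q = "\<Prod>z\<in>eigenvalues L. [:1, -z:] ^ eigenvalue_multiplicity L z"
  define lc where "lc = lead_coeff P"
  have "lc \<noteq> 0" using P_nz by (simp add: lc_def)
  have reflect_linear: "reflect_poly [:-z, 1:] = [:1, -z:]" for z :: complex
    by (cases "z = 0") (simp_all add: reflect_poly_def)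
  have "Sc = reflect_poly P"
    unfolding P using Sc0 by simp
  also have "\<dots> = reflect_poly (smult lc (\<Prod>z\<in>eigenvalues L. [:-z, 1:] ^ eigenvalue_multiplicity L z))"
    unfolding lc_def E eigenvalue_multiplicity_def P_def[symmetric] complex_poly_decompose ..
  also have "\<dots> = smult lc ?Q"
    by (simp add: reflect_poly_smult reflect_poly_prod reflect_poly_power reflect_linear)
  finally have Sc: "Sc = smult lc ?Q" .
  define K where "K = T * S + R"
  define Kc :: "complex poly" where "Kc = map_poly of_rat K"
  have "fps_nth (fps_of_poly S) 0 \<noteq> 0"
    using TR(4) by (simp add: poly_0_coeff_0)
  then have "fps_of_poly R / fps_of_poly S * fps_of_poly S = fps_of_poly R"
    by (simp add: fps_divide_unit mult.assoc inverse_mult_eq_1)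
  then have gS: "generating_function L * fps_of_poly S = fps_of_poly K"
    unfolding TR(1) K_def by (simp add: distrib_right fps_of_poly_add fps_of_poly_mult)
  let ?U = "Abs_fps (\<lambda>l. of_nat (word_count L l)) :: complex fps"
  have "?U * fps_of_poly Sc = fps_of_poly Kc"
  proof (rule fps_ext)
    fix l
    have "(of_rat (fps_nth (generating_function L * fps_of_poly S) l) :: complex) = of_rat (coeff K l)"
      unfolding gS by simp
    then show "fps_nth (?U * fps_of_poly Sc) l = fps_nth (fps_of_poly Kc) l"
      by (simp add: fps_mult_nth of_rat_sum of_rat_mult generating_function_def Sc_def Kc_def coeff_map_poly)
  qed
  then have "fps_const lc * (?U * fps_of_poly ?Q) = fps_of_poly Kc"
    unfolding Sc by (simp add: fps_of_poly_smult mult_ac)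
  then have "fps_const (inverse lc) * (fps_const lc * (?U * fps_of_poly ?Q)) =
      fps_of_poly (smult (inverse lc) Kc)"
    by (simp add: fps_of_poly_smult)
  then have "?U * fps_of_poly ?Q = fps_of_poly (smult (inverse lc) Kc)"
    using \<open>lc \<noteq> 0\<close> by (simp flip: mult.assoc)
  moreover have "poly (smult (inverse lc) Kc) (1 / z) \<noteq> 0" if z: "z \<in> eigenvalues L" for z
  proof -
    have "z \<noteq> 0" using z E0 by auto
    then have "poly Sc (1 / z) = 0"
      using z unfolding E P by (simp add: poly_reflect_poly_nz inverse_eq_divide)
    moreover have "coprime K S"
      unfolding K_def using TR(2)
      by (metis coprime_iff_gcd_eq_1 gcd.commute gcd_add_mult add.commute)
    ultimately show ?thesis
      using \<open>lc \<noteq> 0\<close> coprime_map_poly_of_rat_no_common_root[of K S "1 / z"]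
      unfolding Sc_def Kc_def by simp
  qed
  ultimately show "\<exists>N. ?U * fps_of_poly ?Q = fps_of_poly N \<and> (\<forall>z\<in>eigenvalues L. poly N (1 / z) \<noteq> 0)"
    by blast
qed

theorem theorem4p9:
  fixes A :: "'a set" and L :: "'a list set"
  assumes "finite A" and "rational_language A L" and "infinite L"
  shows "(adev L \<longleftrightarrow> (\<exists>\<gamma>. has_local_growth_rate L \<gamma>)) \<and>
         (\<forall>\<gamma>. has_local_growth_rate L \<gamma> \<longrightarrow> language_modulus L = \<gamma>)"
proof -
  note eig = complex_generating_function_factorization[OF assms]
  let ?E = "eigenvalues L" and ?m = "eigenvalue_multiplicity L"
  define \<rho> where "\<rho> = language_modulus L"
  define D where "D = {z\<in>?E. cmod z = \<rho>}"
  have \<rho>_max: "cmod z \<le> \<rho>" if "z \<in> ?E" for z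
    unfolding \<rho>_def language_modulus_def using that eig(1) by simp
  have "\<rho> \<in> cmod ` ?E"
    unfolding \<rho>_def language_modulus_def using eig(1,2) by (intro Max_in) auto
  then have D: "finite D" "D \<noteq> {}"
    using eig(1) by (auto simp: D_def)
  then obtain z0 where z0: "z0 \<in> ?E" "cmod z0 = \<rho>"
    by (auto simp: D_def)
  then have \<rho>: "\<rho> > 0" using eig(3) by auto
  \<comment> \<open>\<open>Suc n\<close> is the largest multiplicity of an eigenvalue of maximal modulus, so that the number
    of words of length \<open>l\<close> has order of magnitude at most \<open>l ^ n * \<rho> ^ l\<close>.\<close>
  define n where "n = Max (?m ` D) - 1"
  have "Max (?m ` D) \<in> ?m ` D" using D by (intro Max_in) auto
  then obtain z1 where z1: "z1 \<in> D" "?m z1 = Max (?m ` D)" by force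
  moreover have "?m z1 > 0" using z1(1) eig(4)[of z1] by (auto simp: D_def)
  ultimately have n: "Max (?m ` D) = Suc n" by (simp add: n_def)
  have m_le: "?m z \<le> Suc n" if "z \<in> D" for z
    unfolding n[symmetric] using that D by simp
  define J where "J = {z\<in>?E. cmod z = \<rho> \<and> ?m z = Suc n}"
  have J: "finite J" "J \<noteq> {}"
    using eig(1) z1 n by (auto simp: J_def D_def)
  obtain N where N: "Abs_fps (\<lambda>l. of_nat (word_count L l)) *
      fps_of_poly (\<Prod>z\<in>?E. [:1, -z:] ^ ?m z) = fps_of_poly N"
      "\<forall>z\<in>?E. poly N (1 / z) \<noteq> 0"
    using eig(5) by blast
  have dom: "cmod z \<le> \<rho> \<and> (cmod z = \<rho> \<longrightarrow> ?m z \<le> Suc n)" if "z \<in> ?E" for z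
    using that \<rho>_max m_le by (auto simp: D_def)
  define u where "u l = real (word_count L l)" for l
  obtain c where c: "\<And>z. z \<in> J \<Longrightarrow> c z \<noteq> 0" and
    asym: "(\<lambda>l. of_real (u l / (real l ^ n * \<rho> ^ l)) - (\<Sum>z\<in>J. c z * (z / of_real \<rho>) ^ l)) \<longlonglongrightarrow> 0"
    using rational_fps_coefficient_asymptotic[OF eig(1,3) \<rho> N(1) dom] N(2)
    unfolding J_def u_def by auto
  have growth: "has_local_growth_rate L \<gamma> \<longleftrightarrow>
      (\<forall>\<^sub>F l in sequentially. u l \<noteq> 0) \<and> (\<lambda>l. u (Suc l) / u l) \<longlonglongrightarrow> \<gamma>" for \<gamma>
    by (simp add: has_local_growth_rate_def u_def)
  have adev_iff: "adev L \<longleftrightarrow> J = {of_real \<rho>}"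
  proof
    assume adev: "adev L"
    have "z = of_real \<rho>" if z: "z \<in> J" for z
    proof (rule ccontr)
      assume "z \<noteq> of_real \<rho>"
      then have less: "?m z < ?m (of_real \<rho>)"
        using adev z unfolding adev_def \<rho>_def[symmetric] by (auto simp: J_def)
      \<comment> \<open>Its multiplicity exceeds that of \<open>z\<close> and is thus positive, so \<open>\<rho>\<close> is itself an eigenvalue.\<close>
      then have "of_real \<rho> \<in> D"
        using eig(4)[of "of_real \<rho>"] \<rho> by (simp add: D_def)
      then show False using m_le[of "of_real \<rho>"] less z by (simp add: J_def)
    qed
    then show "J = {of_real \<rho>}" using J(2) by auto
  next
    assume J1: "J = {of_real \<rho>}"
    show "adev L"
      unfolding adev_def \<rho>_def[symmetric]
    proof (intro ballI impI)
      fix z assume z: "z \<in> ?E" "cmod z = \<rho> \<and> z \<noteq> of_real \<rho>"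
      then have "z \<notin> J" using J1 by simp
      then have "?m z < Suc n" using z m_le[of z] by (auto simp: J_def D_def)
      moreover have "?m (of_real \<rho>) = Suc n" using J1 by (auto simp: J_def)
      ultimately show "?m z < ?m (of_real \<rho>)" by simp
    qed
  qed
  have sufficient: "has_local_growth_rate L \<rho>" if J1: "J = {of_real \<rho>}"
  proof -
    have "(\<lambda>l. of_real (u l / (real l ^ n * \<rho> ^ l)) - c (of_real \<rho>)) \<longlonglongrightarrow> 0"
      using asym \<rho> unfolding J1 by simp
    then have "(\<lambda>l. complex_of_real (u l / (real l ^ n * \<rho> ^ l))) \<longlonglongrightarrow> c (of_real \<rho>)"
      by (rule LIM_zero_cancel)
    then show ?thesis
      unfolding growth using c J1 by (intro single_term_imp_ratio_tendsto[OF \<rho>]) auto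
  qed
  have necessary: "J = {of_real \<rho>} \<and> \<gamma> = \<rho>" if "has_local_growth_rate L \<gamma>" for \<gamma>
    using that unfolding growth
    by (intro ratio_tendsto_imp_single_term[OF \<rho> J _ asym]) (auto simp: J_def u_def c)
  show ?thesis
    using sufficient necessary unfolding adev_iff \<rho>_def[symmetric] by blast
qed

end
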